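(* Let $U$ and $V$ be real Hilbert spaces, $L:U\to V$ a bounded linear operator, $y\in\mathcal R(L)$, $\nu\in(0,1]$, and let $u^\dagger$ denote the minimum-norm solution of $Lu=y$. Then: (i) the standard source condition with parameter $\nu$ implies the homogeneous variational inequality with the same parameter $\nu$; (ii) the homogeneous variational inequality with parameter $\nu$ implies the inhomogeneous variational inequality with parameter $\mu=\frac{2\nu}{1+\nu}$; (iii) the inhomogeneous variational inequality with parameter $\mu=1$ implies the standard source condition with parameter $1$.
   Context: $\mathcal R(T)$ denotes the range of an operator $T$. For $y\in\mathcal R(L)$, the minimum-norm solution $u^\dagger\in U$ is the unique element with $Lu^\dagger=y$ and $\|u^\dagger\|=\inf\{\|u\|:Lu=y\}$. Powers $(L^*L)^r$, $r>0$, are defined by functional calculus. The following conditions on the problem $Lu=y$ are used. Standard source condition with parameter $\nu\in(0,2]$: $u^\dagger\in\mathcal R((L^*L)^{\frac\nu2})$. Homogeneous variational inequality with parameter $\nu\in(0,1]$: there exists $\beta\ge0$ such that $2\langle u^\dagger,u\rangle\le\beta\|Lu\|^\nu\|u\|^{1-\nu}$ for every $u\in U$ (for $\nu=1$ the factor $\|u\|^{0}$ is read as $1$). Inhomogeneous variational inequality with parameter $\mu\in(0,1]$: there exist $\beta\ge0$ and $\gamma\in[0,1)$ such that $2\langle u^\dagger,u\rangle\le\beta\|Lu\|^\mu+\gamma\|u\|^2$ for every $u\in U$. *)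

theory Defs
  imports "HOL-Analysis.Analysis" "HOL-Computational_Algebra.Polynomial"
begin

(* Real Hilbert spaces are the types of sort {real_inner, complete_space};
   no dimension or separability restriction. *)

definition blinfun_adjoint ::
  "('a::{real_inner,complete_space} \<Rightarrow>\<^sub>L 'b::{real_inner,complete_space}) \<Rightarrow> 'b \<Rightarrow>\<^sub>L 'a" where
  "blinfun_adjoint L = Blinfun (adjoint (blinfun_apply L))"

definition min_norm_solution ::
  "('a::{real_inner,complete_space} \<Rightarrow>\<^sub>L 'b::{real_inner,complete_space}) \<Rightarrow> 'b \<Rightarrow> 'a" where
  "min_norm_solution L y =
     (THE u. blinfun_apply L u = y \<and> norm u = Inf {norm v | v. blinfun_apply L v = y})"

(* Only real points of the spectrum. The operators considered below are self-adjoint, so on a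
   real Hilbert space this is the whole spectrum (of the complexified operator). *)
definition op_spectrum :: "('a::{real_inner,complete_space} \<Rightarrow>\<^sub>L 'a) \<Rightarrow> real set" where
  "op_spectrum A =
     {t. \<not> (\<exists>R. R o\<^sub>L (A - t *\<^sub>R id_blinfun) = id_blinfun \<and>
              (A - t *\<^sub>R id_blinfun) o\<^sub>L R = id_blinfun)}"

definition op_poly ::
  "real poly \<Rightarrow> ('a::{real_inner,complete_space} \<Rightarrow>\<^sub>L 'a) \<Rightarrow> 'a \<Rightarrow>\<^sub>L 'a" where
  "op_poly p A = (\<Sum>i\<le>degree p. coeff p i *\<^sub>R (((o\<^sub>L) A ^^ i) id_blinfun))"

(* Continuous functional calculus: f(A), for A self-adjoint and f continuous on the spectrum of A,
   is the operator norm limit of p_n(A) for any polynomials p_n converging to f uniformly on the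
   spectrum. Such p_n exist by the Weierstrass theorem, and the limit exists and is independent
   of their choice because the norm of p(A) is the maximum of |p| on the spectrum. *)
definition op_calculus ::
  "(real \<Rightarrow> real) \<Rightarrow> ('a::{real_inner,complete_space} \<Rightarrow>\<^sub>L 'a) \<Rightarrow> 'a \<Rightarrow>\<^sub>L 'a" where
  "op_calculus f A =
     (THE B. \<forall>p. uniform_limit (op_spectrum A) (\<lambda>n. poly (p n)) f sequentially \<longrightarrow>
                 (\<lambda>n. op_poly (p n) A) \<longlonglongrightarrow> B)"

(* For r > 0 the function t powr r is continuous on the nonnegative reals with value 0 at 0. The
   spectrum of the positive operators used below is nonnegative, so the value of powr at
   negative t plays no role. *)
definition op_powr :: "('a::{real_inner,complete_space} \<Rightarrow>\<^sub>L 'a) \<Rightarrow> real \<Rightarrow> 'a \<Rightarrow>\<^sub>L 'a" where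
  "op_powr A r = op_calculus (\<lambda>t. t powr r) A"

(* In the following conditions u is the minimum-norm solution. *)

definition source_condition ::
  "('a::{real_inner,complete_space} \<Rightarrow>\<^sub>L 'b::{real_inner,complete_space}) \<Rightarrow> 'a \<Rightarrow> real \<Rightarrow> bool" where
  "source_condition L u \<nu> \<longleftrightarrow>
     u \<in> range (blinfun_apply (op_powr (blinfun_adjoint L o\<^sub>L L) (\<nu> / 2)))"

(* Since 0 powr 0 = 0, the convention that the factor is 1 for exponent 0 is explicit. *)
definition homogeneous_VI ::
  "('a::{real_inner,complete_space} \<Rightarrow>\<^sub>L 'b::{real_inner,complete_space}) \<Rightarrow> 'a \<Rightarrow> real \<Rightarrow> bool" where
  "homogeneous_VI L u \<nu> \<longleftrightarrow>
     (\<exists>\<beta>\<ge>0. \<forall>v. 2 * (u \<bullet> v) \<le>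
        \<beta> * norm (blinfun_apply L v) powr \<nu> * (if \<nu> = 1 then 1 else norm v powr (1 - \<nu>)))"

definition inhomogeneous_VI ::
  "('a::{real_inner,complete_space} \<Rightarrow>\<^sub>L 'b::{real_inner,complete_space}) \<Rightarrow> 'a \<Rightarrow> real \<Rightarrow> bool" where
  "inhomogeneous_VI L u \<mu> \<longleftrightarrow>
     (\<exists>\<beta>\<ge>0. \<exists>\<gamma>\<in>{0..<1}. \<forall>v. 2 * (u \<bullet> v) \<le>
        \<beta> * norm (blinfun_apply L v) powr \<mu> + \<gamma> * (norm v)\<^sup>2)"

end

theory Submission
  imports Defs "HOL-Computational_Algebra.Fundamental_Theorem_Algebra"
begin

text \<open>Let \<open>A = L\<^sup>*L\<close>. For (i), if \<open>u = A\<^bsup>\<nu>/2\<^esup> w\<close>, then \<open>\<langle>u, v\<rangle> = \<langle>w, A\<^bsup>\<nu>/2\<^esup> v\<rangle>\<close>, which is bounded by the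
  interpolation inequality \<open>\<parallel>A\<^bsup>\<nu>/2\<^esup> v\<parallel> \<le> \<parallel>L v\<parallel>\<^sup>\<nu> \<parallel>v\<parallel>\<^bsup>1-\<nu>\<^esup>\<close>. Part (ii) is Young's inequality. For (iii),
  scaling \<open>v\<close> removes the quadratic term, so \<open>\<bar>\<langle>u, v\<rangle>\<bar> \<le> C \<parallel>L v\<parallel> = C \<parallel>A\<^bsup>1/2\<^esup> v\<parallel>\<close>; hence
  \<open>\<langle>u, v\<rangle> = \<langle>w, A\<^bsup>1/2\<^esup> v\<rangle>\<close> for some \<open>w\<close>, that is, \<open>u = A\<^bsup>1/2\<^esup> w\<close>. The functional calculus rests on the bound of
  \<open>\<parallel>p(A)\<parallel>\<close> by the supremum of \<open>\<bar>p\<bar>\<close> on the spectrum: for \<open>N = \<parallel>p(A)\<parallel>\<close> the operator \<open>N\<^sup>2 - p(A)\<^sup>2\<close> is not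
  bounded below, so one of the real irreducible factors of the polynomial \<open>N\<^sup>2 - p\<^sup>2\<close> yields a
  spectral point \<open>t\<close> with \<open>\<bar>p(t)\<bar> = N\<close>.\<close>

section \<open>Representation of functionals and adjoints\<close>

text \<open>The values \<open>S v\<^sub>n\<close> along a minimizing sequence of \<open>\<parallel>S v\<parallel>\<^sup>2 - 2 f(v)\<close> converge to \<open>w\<close>; the case
  \<open>S = id\<close> is the Riesz representation theorem.\<close>

lemma functional_factorization:
  fixes S :: "'a::real_inner \<Rightarrow> 'b::{real_inner,complete_space}" and f :: "'a \<Rightarrow> real"
  assumes S: "linear S" and f: "linear f" and bound: "\<And>v. \<bar>f v\<bar> \<le> C * norm (S v)"
  obtains w where "\<And>v. f v = w \<bullet> S v"
proof -
  define J where "J v = (norm (S v))\<^sup>2 - 2 * f v" for v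
  define m where "m = Inf (range J)"
  \<comment> \<open>Completing the square: with s = \<open>norm (S v)\<close>, the bound on
    \<open>f\<close> makes \<open>J v\<close> at least s^2 - 2 C s = (s - C)^2 - C^2.\<close>
  have "- (C\<^sup>2) \<le> J v" for v
  proof -
    have "0 \<le> (norm (S v) - C)\<^sup>2" by simp
    moreover have "2 * f v \<le> 2 * (C * norm (S v))" using bound[of v] by linarith
    ultimately show ?thesis by (simp add: J_def power2_diff mult.commute)
  qed
  then have "bdd_below (range J)" by (intro bdd_belowI2)
  then have m_le: "m \<le> J v" for v
    unfolding m_def by (intro cInf_lower) auto
  have "\<exists>v. J v < m + inverse (Suc n)" for n
  proof -
    have "Inf (range J) < m + inverse (Suc n)" by (simp add: m_def)
    from cInf_lessD[OF _ this] show ?thesis by blast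
  qed
  then obtain v where v: "\<And>n. J (v n) < m + inverse (Suc n)" by metis
  \<comment> \<open>The linear part of \<open>J\<close> cancels. As \<open>J\<close> is at least
    \<open>m\<close> at the midpoint, two values of \<open>J\<close> below
    \<open>m + e\<^sup>2 / 4\<close> force the images under \<open>S\<close> to be closer than
    \<open>e\<close>.\<close>
  have parallelogram: "(norm (S a - S b))\<^sup>2 = 2 * J a + 2 * J b - 4 * J ((1/2) *\<^sub>R (a + b))" for a b
    unfolding J_def
    by (simp add: linear_add[OF S] linear_scale[OF S] linear_add[OF f] linear_scale[OF f]
        power2_norm_eq_inner inner_simps inner_commute algebra_simps)
  have "Cauchy (\<lambda>n. S (v n))"
  proof (rule metric_CauchyI)
    fix e :: real assume "0 < e"
    obtain N where N: "inverse (real (Suc N)) < e\<^sup>2 / 4"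
      using reals_Archimedean[of "e\<^sup>2 / 4"] \<open>0 < e\<close> by auto
    have close: "J (v n) < m + e\<^sup>2 / 4" if "N \<le> n" for n
    proof -
      have "inverse (real (Suc n)) \<le> inverse (real (Suc N))"
        using that by (intro le_imp_inverse_le) auto
      then show ?thesis using v[of n] N by linarith
    qed
    have "dist (S (v j)) (S (v k)) < e" if "N \<le> j" "N \<le> k" for j k
    proof -
      have "(norm (S (v j) - S (v k)))\<^sup>2 < e\<^sup>2"
        using parallelogram[of "v j" "v k"] close[OF that(1)] close[OF that(2)]
          m_le[of "(1/2) *\<^sub>R (v j + v k)"] by linarith
      then show ?thesis
        using \<open>0 < e\<close> by (simp add: dist_norm power2_less_imp_less)
    qed
    then show "\<exists>M. \<forall>j\<ge>M. \<forall>k\<ge>M. dist (S (v j)) (S (v k)) < e" by blast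
  qed
  then obtain w where w: "(\<lambda>n. S (v n)) \<longlonglongrightarrow> w"
    using Cauchy_convergent by (auto simp: convergent_def)
  have "f x = w \<bullet> S x" for x
  proof -
    define D where "D = w \<bullet> S x - f x"
    \<comment> \<open>Minimality tested at \<open>v n + t *\<^sub>R x\<close>, in the limit over
      \<open>n\<close>. A quadratic in \<open>t\<close> without constant term that is never negative
      has linear coefficient 0.\<close>
    have "0 \<le> 2 * t * D + t\<^sup>2 * (norm (S x))\<^sup>2" for t
    proof -
      have "0 \<le> inverse (real (Suc n)) + 2 * t * (S (v n) \<bullet> S x - f x) + t\<^sup>2 * (norm (S x))\<^sup>2" for n
      proof -
        have "J (v n + t *\<^sub>R x) = J (v n) + 2 * t * (S (v n) \<bullet> S x - f x) + t\<^sup>2 * (norm (S x))\<^sup>2"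
          unfolding J_def
          by (simp add: linear_add[OF S] linear_scale[OF S] linear_add[OF f] linear_scale[OF f]
              power2_norm_eq_inner inner_simps inner_commute algebra_simps power2_eq_square[of t])
        then show ?thesis using m_le[of "v n + t *\<^sub>R x"] v[of n] by linarith
      qed
      moreover have "(\<lambda>n. inverse (real (Suc n)) + 2 * t * (S (v n) \<bullet> S x - f x) + t\<^sup>2 * (norm (S x))\<^sup>2)
          \<longlonglongrightarrow> 0 + 2 * t * (w \<bullet> S x - f x) + t\<^sup>2 * (norm (S x))\<^sup>2"
        by (intro tendsto_intros LIMSEQ_inverse_real_of_nat w)
      ultimately show ?thesis
        unfolding D_def by (intro LIMSEQ_le_const[where a = 0]) auto
    qed
    define N where "N = (norm (S x))\<^sup>2"
    \<comment> \<open>The quadratic will be tested at \<open>t = - s * D\<close>; the added 1 keeps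
      \<open>s\<close> positive when \<open>S x = 0\<close>.\<close>
    define s where "s = 1 / (N + 1)"
    have "0 \<le> N" by (simp add: N_def)
    then have "0 < s" "s * N \<le> 1" by (auto simp: s_def divide_simps)
    have "0 \<le> 2 * (- s * D) * D + (- s * D)\<^sup>2 * N" unfolding N_def by fact
    also have "\<dots> = s * D\<^sup>2 * (s * N - 2)" by (simp add: algebra_simps power2_eq_square)
    also have "\<dots> \<le> s * D\<^sup>2 * (- 1)" using \<open>0 < s\<close> \<open>s * N \<le> 1\<close> by (intro mult_left_mono) auto
    finally have "D = 0" using \<open>0 < s\<close> by (simp add: mult_le_0_iff)
    then show ?thesis by (simp add: D_def)
  qed
  then show thesis by (rule that)
qed

text \<open>\<open>adjoint\<close> is a choice operator, so existence comes first, by Riesz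
  representation of the functional \<open>L x \<bullet> y\<close> of \<open>x\<close>.
  \<open>Blinfun\<close> can be unfolded only once the adjoint is known to be bounded and
  linear.\<close>

lemma blinfun_adjoint_inner:
  fixes L :: "'a::{real_inner,complete_space} \<Rightarrow>\<^sub>L 'b::{real_inner,complete_space}"
  shows "blinfun_adjoint L y \<bullet> x = y \<bullet> L x"
proof -
  have "\<exists>w. \<forall>x. L x \<bullet> y = x \<bullet> w" for y
  proof -
    have lin: "linear (\<lambda>x. L x \<bullet> y)"
      by (rule linearI) (simp_all add: blinfun.bilinear_simps inner_simps)
    have "\<bar>L x \<bullet> y\<bar> \<le> (norm y * norm L) * norm (id x)" for x
    proof -
      have "\<bar>L x \<bullet> y\<bar> \<le> norm (L x) * norm y" by (rule Cauchy_Schwarz_ineq2)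
      also have "\<dots> \<le> (norm L * norm x) * norm y" by (intro mult_right_mono norm_blinfun) auto
      finally show ?thesis by (simp add: mult_ac)
    qed
    from functional_factorization[OF linear_id lin this]
    obtain w where "\<And>x. L x \<bullet> y = w \<bullet> id x" by metis
    then show ?thesis by (auto simp: inner_commute)
  qed
  then obtain g where g: "\<forall>x y. L x \<bullet> y = x \<bullet> g y" by metis
  then have adj: "L x \<bullet> y = x \<bullet> adjoint L y" for x y
    by (simp add: adjoint_unique[OF g])
  have "bounded_linear (adjoint L)"
  proof (rule bounded_linear_intro[where K = "norm L"])
    show "adjoint L (x + y) = adjoint L x + adjoint L y" for x y
      by (rule vector_eq_ldot[THEN iffD1]) (simp add: adj[symmetric] inner_simps)
    show "adjoint L (r *\<^sub>R x) = r *\<^sub>R adjoint L x" for r x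
      by (rule vector_eq_ldot[THEN iffD1]) (simp add: adj[symmetric] inner_simps)
    show "norm (adjoint L x) \<le> norm x * norm L" for x
    proof -
      have "norm (adjoint L x) * norm (adjoint L x) = L (adjoint L x) \<bullet> x"
        by (simp add: adj power2_norm_eq_inner[symmetric] power2_eq_square)
      also have "\<dots> \<le> norm (L (adjoint L x)) * norm x" by (rule norm_cauchy_schwarz)
      also have "\<dots> \<le> (norm L * norm (adjoint L x)) * norm x"
        by (intro mult_right_mono norm_blinfun) auto
      finally have "norm (adjoint L x) * norm (adjoint L x) \<le> norm (adjoint L x) * (norm x * norm L)"
        by (simp add: mult_ac)
      then show ?thesis
        by (cases "adjoint L x = 0") auto
    qed
  qed
  then show ?thesis
    using adj[of x y] by (simp add: blinfun_adjoint_def bounded_linear_Blinfun_apply inner_commute)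
qed

lemma inner_blinfun_adjoint:
  fixes L :: "'a::{real_inner,complete_space} \<Rightarrow>\<^sub>L 'b::{real_inner,complete_space}"
  shows "x \<bullet> blinfun_adjoint L y = L x \<bullet> y"
  using blinfun_adjoint_inner[of L y x] by (simp add: inner_commute)

section \<open>Self-adjoint operators and their spectrum\<close>

definition selfadjoint :: "('a::{real_inner,complete_space} \<Rightarrow>\<^sub>L 'a) \<Rightarrow> bool" where
  "selfadjoint A \<longleftrightarrow> (\<forall>x y. A x \<bullet> y = x \<bullet> A y)"

definition bounded_below :: "('a::real_normed_vector \<Rightarrow>\<^sub>L 'b::real_normed_vector) \<Rightarrow> bool" where
  "bounded_below T \<longleftrightarrow> (\<exists>c>0. \<forall>x. c * norm x \<le> norm (T x))"

lemma selfadjoint_shift: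
  "selfadjoint A \<Longrightarrow> selfadjoint (A - t *\<^sub>R id_blinfun)"
  by (simp add: selfadjoint_def blinfun.bilinear_simps inner_simps)

text \<open>The lower bound yields injectivity and boundedness of the inverse. Surjectivity comes
  from self-adjointness: \<open>y \<bullet> v\<close> is bounded by a multiple of
  \<open>norm (A v)\<close>, hence equals \<open>w \<bullet> A v = A w \<bullet> v\<close> for some
  \<open>w\<close>, so \<open>y = A w\<close>.\<close>

lemma selfadjoint_invertible:
  assumes A: "selfadjoint A" and "bounded_below A"
  obtains R where "R o\<^sub>L A = id_blinfun" "A o\<^sub>L R = id_blinfun"
proof -
  obtain c where c: "0 < c" "\<And>x. c * norm x \<le> norm (A x)"
    using assms(2) by (auto simp: bounded_below_def)
  have lin: "linear (blinfun_apply A)"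
    by (rule linearI) (simp_all add: blinfun.bilinear_simps)
  have "\<exists>w. A w = y" for y
  proof -
    have lin_y: "linear (\<lambda>v. y \<bullet> v)"
      by (rule linearI) (simp_all add: inner_simps)
    have "\<bar>y \<bullet> v\<bar> \<le> (norm y / c) * norm (A v)" for v
    proof -
      have "\<bar>y \<bullet> v\<bar> \<le> norm y * norm v" by (rule Cauchy_Schwarz_ineq2)
      also have "norm v \<le> norm (A v) / c" using c by (simp add: field_simps)
      finally show ?thesis by (simp add: mult_left_mono)
    qed
    from functional_factorization[OF lin lin_y this]
    obtain w where "\<And>v. y \<bullet> v = w \<bullet> A v" by metis
    then have "A w \<bullet> v = y \<bullet> v" for v
      using A by (simp add: selfadjoint_def)
    then show ?thesis using vector_eq_rdot by blast
  qed
  then obtain g where g: "\<And>y. A (g y) = y" by metis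
  have inj: "x = y" if "A x = A y" for x y
  proof -
    have "c * norm (x - y) \<le> 0" using c(2)[of "x - y"] that by (simp add: blinfun.bilinear_simps)
    then show ?thesis using c(1) by (simp add: mult_le_0_iff)
  qed
  have "bounded_linear g"
  proof (rule bounded_linear_intro[where K = "1 / c"])
    show "g (x + y) = g x + g y" for x y by (rule inj) (simp add: g blinfun.bilinear_simps)
    show "g (r *\<^sub>R x) = r *\<^sub>R g x" for r x by (rule inj) (simp add: g blinfun.bilinear_simps)
    show "norm (g x) \<le> norm x * (1 / c)" for x
      using c(2)[of "g x"] c(1) by (simp add: g field_simps)
  qed
  then have R: "blinfun_apply (Blinfun g) = g" by (rule bounded_linear_Blinfun_apply)
  show thesis
  proof (rule that)
    show "Blinfun g o\<^sub>L A = id_blinfun" by (rule blinfun_eqI) (simp add: R inj g)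
    show "A o\<^sub>L Blinfun g = id_blinfun" by (rule blinfun_eqI) (simp add: R g)
  qed
qed

text \<open>Replaces invertibility by a norm inequality, the form in which the spectrum is handled
  from here on.\<close>

lemma notin_spectrum_iff:
  assumes "selfadjoint A"
  shows "t \<notin> op_spectrum A \<longleftrightarrow> bounded_below (A - t *\<^sub>R id_blinfun)" (is "_ \<longleftrightarrow> bounded_below ?T")
proof
  assume "bounded_below ?T"
  with selfadjoint_shift[OF assms] obtain R where "R o\<^sub>L ?T = id_blinfun" "?T o\<^sub>L R = id_blinfun"
    by (rule selfadjoint_invertible)
  then show "t \<notin> op_spectrum A" by (auto simp: op_spectrum_def)
next
  assume "t \<notin> op_spectrum A"
  then obtain R where R: "R o\<^sub>L ?T = id_blinfun" by (auto simp: op_spectrum_def)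
  \<comment> \<open>The added 1 keeps the constant positive on the trivial space, where
    \<open>R = 0\<close>.\<close>
  have "norm x \<le> (norm R + 1) * norm (?T x)" for x
  proof -
    have "norm x = norm ((R o\<^sub>L ?T) x)" by (simp only: R blinfun_apply_id_blinfun id_apply)
    also have "\<dots> \<le> norm R * norm (?T x)" by (simp add: norm_blinfun)
    also have "\<dots> \<le> (norm R + 1) * norm (?T x)" by (intro mult_right_mono) auto
    finally show ?thesis .
  qed
  moreover have "0 < norm R + 1" by (simp add: add_nonneg_pos)
  ultimately show "bounded_below ?T"
    unfolding bounded_below_def
    by (intro exI[of _ "1 / (norm R + 1)"]) (simp add: field_simps)
qed

lemma op_spectrum_le_norm:
  assumes "selfadjoint A"
  shows "op_spectrum A \<subseteq> {- norm A..norm A}"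
proof -
  have "bounded_below (A - t *\<^sub>R id_blinfun)" if "norm A < \<bar>t\<bar>" for t
  proof -
    have "(\<bar>t\<bar> - norm A) * norm x \<le> norm ((A - t *\<^sub>R id_blinfun) x)" for x
    proof -
      have "\<bar>t\<bar> * norm x \<le> norm (A x - t *\<^sub>R x) + norm (A x)"
        using norm_triangle_ineq4[of "A x - t *\<^sub>R x" "A x"] by simp
      then show ?thesis
        using norm_blinfun[of A x] by (simp add: blinfun.bilinear_simps algebra_simps)
    qed
    then show ?thesis using that by (auto simp: bounded_below_def intro: exI[of _ "\<bar>t\<bar> - norm A"])
  qed
  then have "\<bar>t\<bar> \<le> norm A" if "t \<in> op_spectrum A" for t
    using notin_spectrum_iff[OF assms, of t] that by fastforce
  then show ?thesis by fastforce
qed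

text \<open>For \<open>t < 0\<close>, positivity bounds the quadratic form of \<open>A - t\<close>
  below by \<open>- t\<close> times the squared norm, and Cauchy-Schwarz turns this into a lower
  bound for the operator.\<close>

lemma op_spectrum_nonneg:
  assumes A: "selfadjoint A" and pos: "\<And>x. 0 \<le> A x \<bullet> x"
  shows "op_spectrum A \<subseteq> {0..}"
proof -
  have "bounded_below (A - t *\<^sub>R id_blinfun)" if "t < 0" for t
  proof -
    have "- t * norm x \<le> norm ((A - t *\<^sub>R id_blinfun) x)" for x
    proof -
      have "- t * norm x * norm x \<le> (A x - t *\<^sub>R x) \<bullet> x"
        using pos[of x] by (simp add: inner_simps power2_norm_eq_inner[symmetric] power2_eq_square)
      also have "\<dots> \<le> norm (A x - t *\<^sub>R x) * norm x" by (rule norm_cauchy_schwarz)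
      finally show ?thesis
        using mult_right_le_imp_le[of "- t * norm x" "norm x" "norm (A x - t *\<^sub>R x)"]
        by (cases "x = 0") (auto simp: blinfun.bilinear_simps)
    qed
    then show ?thesis using that by (auto simp: bounded_below_def intro: exI[of _ "- t"])
  qed
  then show ?thesis
    using notin_spectrum_iff[OF A] by (meson atLeast_iff not_le subsetI)
qed

section \<open>Polynomials of an operator\<close>

lemma op_poly_0 [simp]: "op_poly 0 A = 0"
  by (simp add: op_poly_def)

lemma op_poly_pCons: "op_poly (pCons a p) A = a *\<^sub>R id_blinfun + (A o\<^sub>L op_poly p A)"
proof (cases "p = 0")
  case False
  have "op_poly (pCons a p) A =
      a *\<^sub>R id_blinfun + (\<Sum>i\<le>degree p. coeff p i *\<^sub>R (A o\<^sub>L ((o\<^sub>L) A ^^ i) id_blinfun))"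
    using False by (simp add: op_poly_def sum.atMost_Suc_shift del: sum.atMost_Suc)
  also have "(\<Sum>i\<le>degree p. coeff p i *\<^sub>R (A o\<^sub>L ((o\<^sub>L) A ^^ i) id_blinfun)) = A o\<^sub>L op_poly p A"
    by (rule blinfun_eqI) (simp add: op_poly_def blinfun.bilinear_simps blinfun.sum_left blinfun.sum_right)
  finally show ?thesis .
qed (simp add: op_poly_def)

lemma op_poly_const: "op_poly [:a:] A = a *\<^sub>R id_blinfun"
  by (simp add: op_poly_pCons)

lemma op_poly_linear: "op_poly [:a, b:] A = a *\<^sub>R id_blinfun + b *\<^sub>R A"
  by (rule blinfun_eqI) (simp add: op_poly_pCons blinfun.bilinear_simps)

lemma op_poly_add: "op_poly (p + q) A = op_poly p A + op_poly q A"
proof (induction p q rule: poly_induct2)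
  case (pCons a p b q)
  then show ?case
    by (intro blinfun_eqI) (simp add: op_poly_pCons blinfun.bilinear_simps algebra_simps)
qed simp

lemma op_poly_smult: "op_poly (smult c p) A = c *\<^sub>R op_poly p A"
proof (induction p)
  case (pCons a p)
  then show ?case
    by (intro blinfun_eqI) (simp add: op_poly_pCons blinfun.bilinear_simps algebra_simps)
qed simp

lemma op_poly_diff: "op_poly (p - q) A = op_poly p A - op_poly q A"
  using op_poly_add[of p "smult (-1) q" A] op_poly_smult[of "-1" q A] by simp

lemma op_poly_mult: "op_poly (p * q) A = op_poly p A o\<^sub>L op_poly q A"
proof (induction p)
  case (pCons a p)
  then show ?case
    by (intro blinfun_eqI)
      (simp add: op_poly_pCons op_poly_add op_poly_smult blinfun.bilinear_simps algebra_simps)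
qed simp

text \<open>The induction step needs \<open>op_poly p A\<close> to commute with \<open>A\<close>,
  which follows from commutativity of polynomial multiplication.\<close>

lemma op_poly_selfadjoint:
  assumes "selfadjoint A"
  shows "selfadjoint (op_poly p A)"
proof (induction p)
  case 0
  show ?case by (simp add: selfadjoint_def)
next
  case (pCons a p)
  have "op_poly p A (A x) = A (op_poly p A x)" for x
    using op_poly_mult[of p "[:0, 1:]" A] op_poly_mult[of "[:0, 1:]" p A]
    by (simp add: op_poly_linear mult.commute[of p] flip: blinfun_apply_blinfun_compose)
  with pCons assms show ?case
    by (simp add: selfadjoint_def op_poly_pCons blinfun.bilinear_simps inner_simps)
qed

section \<open>Real irreducible factors of polynomials\<close>

lemma map_poly_of_real_mult:
  "map_poly complex_of_real (p * q) = map_poly complex_of_real p * map_poly complex_of_real q"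
  by (rule poly_eqI) (simp add: coeff_map_poly coeff_mult)

lemma map_poly_of_real_add:
  "map_poly complex_of_real (p + q) = map_poly complex_of_real p + map_poly complex_of_real q"
  by (rule poly_eqI) (simp add: coeff_map_poly)

lemma poly_map_poly_of_real:
  "poly (map_poly complex_of_real p) (complex_of_real x) = complex_of_real (poly p x)"
  by (induction p) (simp_all add: map_poly_pCons)

text \<open>Take a complex root z = a + ib of \<open>q\<close>. If it is not real, the remainder of
  \<open>q\<close> modulo (X - a)^2 + b^2 is a real polynomial of degree below 2 that vanishes at z;
  comparing imaginary and then real parts shows that it is 0.\<close>

lemma real_poly_factor:
  fixes q :: "real poly"
  assumes "0 < degree q"
  obtains (linear) t where "[:- t, 1:] dvd q" | (quadratic) a b where "b \<noteq> 0" "[:a\<^sup>2 + b\<^sup>2, - 2 * a, 1:] dvd q"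
proof -
  have "\<not> constant (poly (map_poly complex_of_real q))"
    using assms by (simp add: constant_degree degree_map_poly)
  then obtain z where z: "poly (map_poly complex_of_real q) z = 0"
    using fundamental_theorem_of_algebra by blast
  show thesis
  proof (cases "Im z = 0")
    case True
    then have "z = complex_of_real (Re z)" by (simp add: complex_eq_iff)
    with z have "poly q (Re z) = 0" by (metis of_real_eq_0_iff poly_map_poly_of_real)
    then show thesis using linear by (simp add: poly_eq_0_iff_dvd)
  next
    case False
    define a b where "a = Re z" and "b = Im z"
    define m where "m = [:a\<^sup>2 + b\<^sup>2, - 2 * a, 1:]"
    define r where "r = q mod m"
    have "degree r < 2"
      using degree_mod_less'[of m q] by (cases "r = 0") (auto simp: r_def m_def)
    then have r: "r = [:coeff r 0, coeff r 1:]"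
      by (intro poly_eqI) (auto simp: coeff_pCons coeff_eq_0 split: nat.split)
    have "poly (map_poly complex_of_real m) z = 0"
      by (simp add: m_def map_poly_pCons complex_eq_iff a_def b_def power2_eq_square algebra_simps)
    moreover have "q = q div m * m + r" by (simp add: r_def)
    ultimately have "poly (map_poly complex_of_real r) z = 0"
      using z by (metis add_0 map_poly_of_real_add map_poly_of_real_mult mult_zero_right poly_add poly_mult)
    then have "complex_of_real (coeff r 0) + z * complex_of_real (coeff r 1) = 0"
      by (subst (asm) r) (simp add: map_poly_pCons)
    then have "coeff r 1 = 0" "coeff r 0 = 0"
      using False by (auto simp: complex_eq_iff)
    then have "r = 0" by (subst r) simp
    then have "m dvd q" by (simp add: r_def mod_eq_0_iff_dvd)
    then show thesis using quadratic[of b a] False by (simp add: m_def b_def)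
  qed
qed

section \<open>Lower bounds and norms of polynomials of an operator\<close>

lemma bounded_below_compose:
  assumes "bounded_below S" "bounded_below T"
  shows "bounded_below (S o\<^sub>L T)"
proof -
  obtain c d where c: "0 < c" "\<And>x. c * norm x \<le> norm (S x)"
    and d: "0 < d" "\<And>x. d * norm x \<le> norm (T x)"
    using assms by (auto simp: bounded_below_def)
  have "c * d * norm x \<le> norm (S (T x))" for x
  proof -
    have "c * (d * norm x) \<le> c * norm (T x)" using c(1) d(2) by (intro mult_left_mono) auto
    also have "\<dots> \<le> norm (S (T x))" by (rule c(2))
    finally show ?thesis by (simp add: mult.assoc)
  qed
  then show ?thesis
    using c(1) d(1) by (auto simp: bounded_below_def intro!: exI[of _ "c * d"])
qed

text \<open>Factors are split off one at a time. A linear factor is bounded below because its root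
  lies outside the spectrum; a quadratic factor (A - a)^2 + b^2 is bounded below by b^2, since the
  square of a self-adjoint operator has a nonnegative quadratic form.\<close>

lemma op_poly_bounded_below:
  assumes A: "selfadjoint A"
  shows "q \<noteq> 0 \<Longrightarrow> (\<And>t. t \<in> op_spectrum A \<Longrightarrow> poly q t \<noteq> 0) \<Longrightarrow> bounded_below (op_poly q A)"
proof (induction "degree q" arbitrary: q rule: less_induct)
  case less
  \<comment> \<open>The cofactor \<open>r\<close> has smaller degree and inherits the absence of
    spectral roots.\<close>
  have step: ?case if "q = m * r" "0 < degree m" "bounded_below (op_poly m A)" for m r
  proof -
    have "r \<noteq> 0" "m \<noteq> 0" using less.prems(1) that(1) by auto
    moreover from this have "degree r < degree q" using that by (simp add: degree_mult_eq)
    ultimately have "bounded_below (op_poly r A)"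
      using less.prems(2) that(1) by (intro less.hyps) auto
    then show ?thesis using that by (simp add: op_poly_mult bounded_below_compose)
  qed
  show ?case
  proof (cases "degree q = 0")
    case True
    then obtain a where "q = [:a:]" by (rule degree_eq_zeroE)
    then show ?thesis
      using less.prems(1) by (auto simp: op_poly_const bounded_below_def blinfun.bilinear_simps
          intro!: exI[of _ "\<bar>a\<bar>"])
  next
    case False
    then have "0 < degree q" by simp
    then show ?thesis
    proof (cases rule: real_poly_factor)
      case (linear t)
      then obtain r where r: "q = [:- t, 1:] * r" by blast
      then have "t \<notin> op_spectrum A" using less.prems(2) by fastforce
      then have "bounded_below (op_poly [:- t, 1:] A)"
        using notin_spectrum_iff[OF A] by (simp add: op_poly_linear)
      then show ?thesis using r by (intro step[of "[:- t, 1:]" r]) auto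
    next
      case (quadratic a b)
      define m where "m = [:a\<^sup>2 + b\<^sup>2, - 2 * a, 1:]"
      obtain r where r: "q = m * r" using quadratic m_def by blast
      have m: "m = [:b\<^sup>2:] + [:- a, 1:] * [:- a, 1:]"
        by (simp add: m_def power2_eq_square)
      have "b\<^sup>2 * norm x \<le> norm (op_poly m A x)" for x
      proof -
        have "b\<^sup>2 * norm x * norm x \<le> b\<^sup>2 * (x \<bullet> x) + op_poly [:- a, 1:] A x \<bullet> op_poly [:- a, 1:] A x"
          by (simp add: power2_norm_eq_inner[symmetric] power2_eq_square)
        also have "\<dots> = op_poly m A x \<bullet> x"
          using op_poly_selfadjoint[OF A, of "[:- a, 1:]"]
          by (simp add: m op_poly_add op_poly_mult op_poly_const selfadjoint_def
              blinfun.bilinear_simps inner_simps del: mult_pCons_left mult_pCons_right)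
        also have "\<dots> \<le> norm (op_poly m A x) * norm x" by (rule norm_cauchy_schwarz)
        finally show ?thesis by (cases "x = 0") auto
      qed
      then have "bounded_below (op_poly m A)"
        using quadratic by (auto simp: bounded_below_def intro!: exI[of _ "b\<^sup>2"])
      then show ?thesis using r by (intro step[of m r]) (auto simp: m_def)
    qed
  qed
qed

text \<open>A norming sequence of \<open>T\<close> is a sequence of approximate eigenvectors of \<open>T\<^sup>2\<close>.\<close>

lemma not_bounded_below_norm_square:
  fixes T :: "'a::{real_inner,complete_space} \<Rightarrow>\<^sub>L 'a"
  assumes T: "selfadjoint T" and "z \<noteq> (0::'a)"
  shows "\<not> bounded_below ((norm T)\<^sup>2 *\<^sub>R id_blinfun - (T o\<^sub>L T))"
proof
  define N where "N = norm T"
  assume "bounded_below ((norm T)\<^sup>2 *\<^sub>R id_blinfun - (T o\<^sub>L T))"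
  then obtain c where c: "0 < c" "\<And>x. c * norm x \<le> norm (N\<^sup>2 *\<^sub>R x - T (T x))"
    by (auto simp: bounded_below_def blinfun.bilinear_simps N_def)
  \<comment> \<open>Expand the square of \<open>norm (N\<^sup>2 *\<^sub>R x - T (T x))\<close>,
    bound it below by \<open>c\<close> and estimate \<open>norm (T (T x))\<close> by
    \<open>N * norm (T x)\<close>. The resulting bound on \<open>norm (T x)\<close> makes the norm
    of \<open>T\<close> strictly smaller than \<open>N\<close>.\<close>
  have key: "N\<^sup>2 * (norm (T x))\<^sup>2 \<le> (N^4 - c\<^sup>2) * (norm x)\<^sup>2" for x
  proof -
    have "norm (T (T x)) \<le> N * norm (T x)" by (simp add: N_def norm_blinfun)
    then have "(norm (T (T x)))\<^sup>2 \<le> N\<^sup>2 * (norm (T x))\<^sup>2"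
      by (metis norm_ge_zero power_mono power_mult_distrib)
    moreover have "T (T x) \<bullet> x = T x \<bullet> T x"
      using T by (simp add: selfadjoint_def)
    then have "(norm (N\<^sup>2 *\<^sub>R x - T (T x)))\<^sup>2
        = N^4 * (norm x)\<^sup>2 - 2 * N\<^sup>2 * (norm (T x))\<^sup>2 + (norm (T (T x)))\<^sup>2"
      by (simp add: power2_norm_eq_inner inner_simps inner_commute[of x "T (T x)"]
          power2_eq_square[of N] power4_eq_xxxx algebra_simps)
    moreover have "(c * norm x)\<^sup>2 \<le> (norm (N\<^sup>2 *\<^sub>R x - T (T x)))\<^sup>2"
      using c by (intro power_mono) auto
    ultimately show ?thesis by (simp add: algebra_simps power_mult_distrib)
  qed
  \<comment> \<open>The nonzero vector \<open>z\<close> guarantees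
    \<open>c\<^sup>2 \<le> N^4\<close>, so the square root below is genuine and \<open>N\<close> is
    positive.\<close>
  have "0 \<le> (N^4 - c\<^sup>2) * (norm z)\<^sup>2" using key[of z] by (smt (verit) zero_le_mult_iff zero_le_power2)
  then have nonneg: "c\<^sup>2 \<le> N^4" using assms(2) by (simp add: zero_le_mult_iff)
  then have "0 < N" using c(1) by (cases "N = 0") (auto simp: N_def)
  have sqrt_square: "(sqrt (N^4 - c\<^sup>2))\<^sup>2 = N^4 - c\<^sup>2" using nonneg by simp
  have "norm T \<le> sqrt (N^4 - c\<^sup>2) / N"
  proof (rule norm_blinfun_bound)
    show "0 \<le> sqrt (N^4 - c\<^sup>2) / N" using nonneg \<open>0 < N\<close> by simp
    show "norm (T x) \<le> sqrt (N^4 - c\<^sup>2) / N * norm x" for x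
    proof -
      have "(N * norm (T x))\<^sup>2 \<le> (sqrt (N^4 - c\<^sup>2) * norm x)\<^sup>2"
        using key[of x] sqrt_square by (simp only: power_mult_distrib)
      then have "N * norm (T x) \<le> sqrt (N^4 - c\<^sup>2) * norm x"
        by (rule power2_le_imp_le) (use nonneg in simp)
      then have "norm (T x) \<le> sqrt (N^4 - c\<^sup>2) * norm x / N"
        using \<open>0 < N\<close> by (simp add: pos_le_divide_eq mult.commute)
      then show ?thesis by simp
    qed
  qed
  then have "N\<^sup>2 \<le> sqrt (N^4 - c\<^sup>2)"
    using \<open>0 < N\<close> by (simp add: N_def[symmetric] field_simps power2_eq_square)
  then have "(N\<^sup>2)\<^sup>2 \<le> (sqrt (N^4 - c\<^sup>2))\<^sup>2" by (intro power_mono) auto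
  then show False using nonneg c(1) by simp
qed

text \<open>With empty spectrum every nonzero polynomial of \<open>A\<close> would be bounded below,
  in particular that of \<open>(norm A)\<^sup>2\<close> minus the square. The vector
  \<open>z\<close> excludes the trivial space, on which the spectrum is empty.\<close>

lemma op_spectrum_nonempty:
  fixes A :: "'a::{real_inner,complete_space} \<Rightarrow>\<^sub>L 'a"
  assumes A: "selfadjoint A" and "z \<noteq> (0::'a)"
  shows "op_spectrum A \<noteq> {}"
proof
  assume "op_spectrum A = {}"
  then have "bounded_below (op_poly [:(norm A)\<^sup>2, 0, -1:] A)"
    by (intro op_poly_bounded_below[OF A]) auto
  moreover have "op_poly [:(norm A)\<^sup>2, 0, -1:] A = (norm A)\<^sup>2 *\<^sub>R id_blinfun - (A o\<^sub>L A)"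
    by (rule blinfun_eqI) (simp add: op_poly_pCons blinfun.bilinear_simps)
  ultimately show False using not_bounded_below_norm_square[OF assms] by simp
qed

lemma norm_op_poly_le:
  fixes A :: "'a::{real_inner,complete_space} \<Rightarrow>\<^sub>L 'a"
  assumes A: "selfadjoint A" and "0 \<le> M" and bound: "\<And>t. t \<in> op_spectrum A \<Longrightarrow> \<bar>poly p t\<bar> \<le> M"
  shows "norm (op_poly p A) \<le> M"
proof (rule ccontr)
  define N where "N = norm (op_poly p A)"
  assume "\<not> norm (op_poly p A) \<le> M"
  then have "M < N" by (simp add: N_def)
  then have "op_poly p A \<noteq> 0" using \<open>0 \<le> M\<close> by (auto simp: N_def)
  then obtain z :: 'a where z: "z \<noteq> 0" by (metis blinfun.zero_left blinfun.zero_right blinfun_eqI)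
  define q where "q = [:N\<^sup>2:] - p * p"
  have root: "poly q t \<noteq> 0" if "t \<in> op_spectrum A" for t
  proof -
    have "\<bar>poly p t\<bar>\<^sup>2 < N\<^sup>2"
      using bound[OF that] \<open>M < N\<close> by (intro power_strict_mono) auto
    then show ?thesis by (simp add: q_def power2_eq_square)
  qed
  \<comment> \<open>The zero polynomial would vanish at a spectral point, and one exists.\<close>
  moreover have "q \<noteq> 0" using op_spectrum_nonempty[OF A z] root by fastforce
  ultimately have "bounded_below (op_poly q A)" by (intro op_poly_bounded_below[OF A])
  moreover have "op_poly q A = N\<^sup>2 *\<^sub>R id_blinfun - (op_poly p A o\<^sub>L op_poly p A)"
    by (simp add: q_def op_poly_diff op_poly_mult op_poly_const)
  ultimately show False
    using not_bounded_below_norm_square[OF op_poly_selfadjoint[OF A] z] by (simp add: N_def)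
qed

text \<open>If \<open>0 \<le> q \<le> 2c\<close> on the spectrum, then \<open>\<bar>c - q\<bar> \<le> c\<close> there, so \<open>c - q(A)\<close> has norm at most \<open>c\<close>.\<close>

lemma op_poly_nonneg:
  assumes A: "selfadjoint A" and nonneg: "\<And>t. t \<in> op_spectrum A \<Longrightarrow> 0 \<le> poly q t"
  shows "0 \<le> op_poly q A x \<bullet> x"
proof -
  have "bounded (poly q ` {- norm A..norm A})"
    by (intro compact_imp_bounded compact_continuous_image continuous_intros) auto
  then obtain M where M: "0 < M" "\<And>t. t \<in> {- norm A..norm A} \<Longrightarrow> \<bar>poly q t\<bar> \<le> M"
    by (auto simp: bounded_pos)
  define c where "c = M / 2"
  have "norm (op_poly ([:c:] - q) A) \<le> c"
  proof (rule norm_op_poly_le[OF A])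
    show "0 \<le> c" using M by (simp add: c_def)
    fix t assume t: "t \<in> op_spectrum A"
    then have "\<bar>poly q t\<bar> \<le> M" using M op_spectrum_le_norm[OF A] by blast
    then have "\<bar>c - poly q t\<bar> \<le> c" using nonneg[OF t] unfolding c_def by linarith
    then show "\<bar>poly ([:c:] - q) t\<bar> \<le> c" by simp
  qed
  moreover have "norm (op_poly ([:c:] - q) A x) \<le> norm (op_poly ([:c:] - q) A) * norm x"
    by (rule norm_blinfun)
  ultimately have "norm (op_poly ([:c:] - q) A x) \<le> c * norm x"
    by (meson mult_right_mono norm_ge_zero order_trans)
  then have "op_poly ([:c:] - q) A x \<bullet> x \<le> c * norm x * norm x"
    by (meson mult_right_mono norm_cauchy_schwarz norm_ge_zero order_trans)
  then show ?thesis
    by (simp add: op_poly_diff op_poly_const blinfun.bilinear_simps inner_simps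
        power2_norm_eq_inner[symmetric] power2_eq_square)
qed

section \<open>Continuous functional calculus\<close>

text \<open>Passes from polynomial functions to the type \<open>poly\<close>, which
  \<open>op_poly\<close> requires, with error below 1/(n+1) at index n.\<close>

lemma Weierstrass_poly:
  fixes f :: "real \<Rightarrow> real"
  assumes "compact S" "continuous_on S f"
  obtains p where "uniform_limit S (\<lambda>n. poly (p n)) f sequentially"
proof -
  have "\<exists>p. \<forall>x\<in>S. \<bar>f x - poly p x\<bar> < inverse (Suc n)" for n
  proof -
    obtain g where g: "real_polynomial_function g" "\<And>x. x \<in> S \<Longrightarrow> \<bar>f x - g x\<bar> < inverse (Suc n)"
      using Stone_Weierstrass_real_polynomial_function[OF assms, of "inverse (Suc n)"] by auto
    obtain a k where "g = (\<lambda>x. \<Sum>i\<le>k. a i * x ^ i)"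
      using g(1) real_polynomial_function_iff_sum by blast
    then have "g = poly (\<Sum>i\<le>(k::nat). monom (a i) i)"
      by (simp add: fun_eq_iff poly_sum poly_monom)
    then show ?thesis using g(2) by blast
  qed
  then obtain p where p: "\<And>n x. x \<in> S \<Longrightarrow> \<bar>f x - poly (p n) x\<bar> < inverse (Suc n)" by metis
  have "uniform_limit S (\<lambda>n. poly (p n)) f sequentially"
  proof (rule uniform_limitI)
    fix e :: real assume "0 < e"
    then have "\<forall>\<^sub>F n in sequentially. inverse (real (Suc n)) < e"
      by (intro order_tendstoD(2)[OF LIMSEQ_inverse_real_of_nat])
    then show "\<forall>\<^sub>F n in sequentially. \<forall>x\<in>S. dist (poly (p n) x) (f x) < e"
    proof eventually_elim
      case (elim n)
      then have "\<bar>f x - poly (p n) x\<bar> < e" if "x \<in> S" for x using p[OF that, of n] by linarith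
      then show ?case by (simp add: dist_real_def abs_minus_commute)
    qed
  qed
  then show thesis by (rule that)
qed

text \<open>The library instance of class \<open>banach\<close> for bounded operators does not apply to a codomain
  that only has sort \<open>complete_space\<close>.\<close>

lemma blinfun_Cauchy_convergent:
  fixes X :: "nat \<Rightarrow> 'a::real_normed_vector \<Rightarrow>\<^sub>L 'b::{real_normed_vector,complete_space}"
  assumes "Cauchy X"
  shows "convergent X"
proof -
  have apply_diff: "norm (X m x - X n x) \<le> norm (X m - X n) * norm x" for m n x
    using norm_blinfun[of "X m - X n" x] by (simp add: blinfun.diff_left)
  have "Cauchy (\<lambda>n. X n x)" for x
    using bounded_linear.Cauchy[OF blinfun.bounded_linear_left assms] .
  then have "\<forall>x. \<exists>l. (\<lambda>n. X n x) \<longlonglongrightarrow> l"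
    by (metis Cauchy_convergent convergent_def)
  then obtain v where v: "\<And>x. (\<lambda>n. X n x) \<longlonglongrightarrow> v x" by metis
  obtain K where K: "0 < K" "\<And>n. norm (X n) \<le> K"
    using Cauchy_Bseq[OF assms] by (auto simp: Bseq_def)
  have "bounded_linear v"
  proof (rule bounded_linear_intro[where K = K])
    show "v (x + y) = v x + v y" for x y
      using tendsto_add[OF v[of x] v[of y]] v[of "x + y"] LIMSEQ_unique
      by (auto simp: blinfun.add_right)
    show "v (r *\<^sub>R x) = r *\<^sub>R v x" for r x
      using tendsto_scaleR[OF tendsto_const[of r] v[of x]] v[of "r *\<^sub>R x"] LIMSEQ_unique
      by (auto simp: blinfun.scaleR_right)
    show "norm (v x) \<le> norm x * K" for x
    proof (rule LIMSEQ_le_const2[OF tendsto_norm[OF v]])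
      have "norm (X n x) \<le> norm x * K" for n
        using norm_blinfun[of "X n" x] mult_right_mono[OF K(2)[of n], of "norm x"]
        by (simp add: mult.commute)
      then show "\<exists>N. \<forall>n\<ge>N. norm (X n x) \<le> norm x * K" by blast
    qed
  qed
  then have B: "blinfun_apply (Blinfun v) = v" by (rule bounded_linear_Blinfun_apply)
  have "X \<longlonglongrightarrow> Blinfun v"
  proof (rule LIMSEQ_I)
    fix e :: real assume "0 < e"
    then obtain N where N: "\<And>m n. N \<le> m \<Longrightarrow> N \<le> n \<Longrightarrow> norm (X m - X n) < e / 2"
      using CauchyD[OF assms, of "e / 2"] by auto
    have "norm (X n - Blinfun v) < e" if "N \<le> n" for n
    proof -
      have "norm (X n x - v x) \<le> e / 2 * norm x" for x
      proof (rule LIMSEQ_le_const2)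
        show "(\<lambda>m. norm (X n x - X m x)) \<longlonglongrightarrow> norm (X n x - v x)"
          by (intro tendsto_intros v)
        have "norm (X n x - X m x) \<le> e / 2 * norm x" if "N \<le> m" for m
          using apply_diff[of n x m] mult_right_mono[OF less_imp_le[OF N[OF \<open>N \<le> n\<close> that]], of "norm x"]
          by simp
        then show "\<exists>M. \<forall>m\<ge>M. norm (X n x - X m x) \<le> e / 2 * norm x" by blast
      qed
      then have "norm (X n - Blinfun v) \<le> e / 2"
        using \<open>0 < e\<close> by (intro norm_blinfun_bound) (simp_all add: blinfun.diff_left B)
      then show ?thesis using \<open>0 < e\<close> by simp
    qed
    then show "\<exists>M. \<forall>n\<ge>M. norm (X n - Blinfun v) < e" by blast
  qed
  then show ?thesis by (auto simp: convergent_def)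
qed

lemma op_poly_null_limit:
  assumes A: "selfadjoint A" and "uniform_limit (op_spectrum A) (\<lambda>n. poly (p n)) (\<lambda>_. 0) F"
  shows "((\<lambda>n. op_poly (p n) A) \<longlongrightarrow> 0) F"
proof (rule tendstoI)
  fix e :: real assume "0 < e"
  then have "\<forall>\<^sub>F n in F. \<forall>t\<in>op_spectrum A. dist (poly (p n) t) 0 < e / 2"
    using assms(2) by (intro uniform_limitD) auto
  then show "\<forall>\<^sub>F n in F. dist (op_poly (p n) A) 0 < e"
  proof eventually_elim
    case (elim n)
    then have "norm (op_poly (p n) A) \<le> e / 2"
      using \<open>0 < e\<close> by (intro norm_op_poly_le[OF A]) force+
    then show ?case using \<open>0 < e\<close> by simp
  qed
qed

lemma op_poly_Cauchy:
  assumes A: "selfadjoint A"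
    and lim: "uniform_limit (op_spectrum A) (\<lambda>n. poly (p n)) f sequentially"
  shows "Cauchy (\<lambda>n. op_poly (p n) A)"
proof (rule metric_CauchyI)
  fix e :: real assume "0 < e"
  then have "\<forall>\<^sub>F n in sequentially. \<forall>t\<in>op_spectrum A. dist (poly (p n) t) (f t) < e / 4"
    using lim by (intro uniform_limitD) auto
  then obtain N where N: "\<And>n t. N \<le> n \<Longrightarrow> t \<in> op_spectrum A \<Longrightarrow> \<bar>poly (p n) t - f t\<bar> < e / 4"
    by (auto simp: eventually_sequentially dist_real_def)
  have "dist (op_poly (p j) A) (op_poly (p k) A) < e" if "N \<le> j" "N \<le> k" for j k
  proof -
    have "norm (op_poly (p j - p k) A) \<le> e / 2"
    proof (rule norm_op_poly_le[OF A])
      fix t assume "t \<in> op_spectrum A"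
      then show "\<bar>poly (p j - p k) t\<bar> \<le> e / 2"
        using N[OF that(1)] N[OF that(2)] by (simp add: poly_diff) (smt (verit) field_sum_of_halves)
    qed (use \<open>0 < e\<close> in simp)
    then show ?thesis using \<open>0 < e\<close> by (simp add: dist_norm op_poly_diff)
  qed
  then show "\<exists>M. \<forall>j\<ge>M. \<forall>k\<ge>M. dist (op_poly (p j) A) (op_poly (p k) A) < e" by blast
qed

text \<open>Justifies the \<open>THE\<close> in \<open>op_calculus\<close>. Two approximating
  sequences differ by polynomials tending to 0 uniformly on the spectrum, so by the norm bound their
  operators have the same limit. \<open>S\<close> is the compact set on which Weierstrass
  approximation is applied.\<close>

lemma op_calculus_limit:
  assumes A: "selfadjoint A" and S: "compact S" "op_spectrum A \<subseteq> S" and f: "continuous_on S f"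
    and lim: "uniform_limit (op_spectrum A) (\<lambda>n. poly (p n)) f sequentially"
  shows "(\<lambda>n. op_poly (p n) A) \<longlonglongrightarrow> op_calculus f A"
proof -
  obtain q where "uniform_limit S (\<lambda>n. poly (q n)) f sequentially"
    using Weierstrass_poly[OF S(1) f] .
  then have q: "uniform_limit (op_spectrum A) (\<lambda>n. poly (q n)) f sequentially"
    using S(2) by (rule uniform_limit_on_subset)
  obtain B where B: "(\<lambda>n. op_poly (q n) A) \<longlonglongrightarrow> B"
    using blinfun_Cauchy_convergent[OF op_poly_Cauchy[OF A q]] by (auto simp: convergent_def)
  have conv: "(\<lambda>n. op_poly (r n) A) \<longlonglongrightarrow> B"
    if r: "uniform_limit (op_spectrum A) (\<lambda>n. poly (r n)) f sequentially" for r
  proof -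
    have "(\<lambda>n. poly (r n - q n)) = (\<lambda>n t. poly (r n) t - poly (q n) t)"
      by (simp add: fun_eq_iff)
    with uniform_limit_minus[OF r q]
    have "uniform_limit (op_spectrum A) (\<lambda>n. poly (r n - q n)) (\<lambda>_. 0) sequentially"
      by (simp only: diff_self)
    then have "(\<lambda>n. op_poly (r n - q n) A) \<longlonglongrightarrow> 0" by (rule op_poly_null_limit[OF A])
    from tendsto_add[OF this B] show ?thesis by (simp add: op_poly_diff)
  qed
  have "op_calculus f A = B"
    unfolding op_calculus_def
  proof (rule the_equality)
    show "\<forall>p. uniform_limit (op_spectrum A) (\<lambda>n. poly (p n)) f sequentially
        \<longrightarrow> (\<lambda>n. op_poly (p n) A) \<longlonglongrightarrow> B"
      using conv by blast
    \<comment> \<open>Uniqueness rests on the existence of \<open>q\<close>: without an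
      approximating sequence every \<open>C\<close> would satisfy the condition vacuously.\<close>
    show "C = B" if "\<forall>p. uniform_limit (op_spectrum A) (\<lambda>n. poly (p n)) f sequentially
        \<longrightarrow> (\<lambda>n. op_poly (p n) A) \<longlonglongrightarrow> C" for C
      using that q by (intro LIMSEQ_unique[OF _ B]) simp
  qed
  then show ?thesis using conv[OF lim] by simp
qed

lemma op_calculus_approx:
  assumes "selfadjoint A" "compact S" "op_spectrum A \<subseteq> S" "continuous_on S f"
  obtains p where "uniform_limit S (\<lambda>n. poly (p n)) f sequentially"
    "(\<lambda>n. op_poly (p n) A) \<longlonglongrightarrow> op_calculus f A"
proof -
  obtain p where p: "uniform_limit S (\<lambda>n. poly (p n)) f sequentially"
    using Weierstrass_poly[OF assms(2,4)] .
  show thesis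
    using p op_calculus_limit[OF assms uniform_limit_on_subset[OF p assms(3)]] by (rule that)
qed

text \<open>Allows \<open>t powr 1\<close> to be replaced by the polynomial \<open>t\<close>, with
  which it agrees on a nonnegative spectrum.\<close>

lemma op_calculus_cong:
  assumes "\<And>t. t \<in> op_spectrum A \<Longrightarrow> f t = g t"
  shows "op_calculus f A = op_calculus g A"
proof -
  have "uniform_limit (op_spectrum A) (\<lambda>n. poly (p n)) f sequentially \<longleftrightarrow>
      uniform_limit (op_spectrum A) (\<lambda>n. poly (p n)) g sequentially" for p
    using assms by (intro uniform_limit_cong') auto
  then show ?thesis by (simp only: op_calculus_def)
qed

lemma op_calculus_poly:
  assumes A: "selfadjoint A"
  shows "op_calculus (poly p) A = op_poly p A"
proof -
  have "(\<lambda>n. op_poly p A) \<longlonglongrightarrow> op_calculus (poly p) A"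
    using op_spectrum_le_norm[OF A]
    by (intro op_calculus_limit[OF A, of "{- norm A..norm A}"] continuous_intros uniform_limit_const) auto
  then show ?thesis by (rule LIMSEQ_unique) (rule tendsto_const)
qed

lemma op_calculus_selfadjoint:
  assumes A: "selfadjoint A" and S: "compact S" "op_spectrum A \<subseteq> S" and f: "continuous_on S f"
  shows "selfadjoint (op_calculus f A)"
  unfolding selfadjoint_def
proof (intro allI)
  fix x y
  obtain p where p: "(\<lambda>n. op_poly (p n) A) \<longlonglongrightarrow> op_calculus f A"
    using op_calculus_approx[OF assms] .
  have sym: "op_poly (p n) A x \<bullet> y = x \<bullet> op_poly (p n) A y" for n
    using op_poly_selfadjoint[OF A] by (simp add: selfadjoint_def)
  have "(\<lambda>n. op_poly (p n) A x \<bullet> y) \<longlonglongrightarrow> op_calculus f A x \<bullet> y"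
    by (intro tendsto_intros p)
  moreover have "(\<lambda>n. op_poly (p n) A x \<bullet> y) \<longlonglongrightarrow> x \<bullet> op_calculus f A y"
    unfolding sym by (intro tendsto_intros p)
  ultimately show "op_calculus f A x \<bullet> y = x \<bullet> op_calculus f A y"
    by (rule LIMSEQ_unique)
qed

text \<open>Products of the approximating polynomials converge uniformly because \<open>f\<close>
  and \<open>g\<close> are bounded on the compact set \<open>S\<close>.\<close>

lemma op_calculus_mult:
  assumes A: "selfadjoint A" and S: "compact S" "op_spectrum A \<subseteq> S"
    and f: "continuous_on S f" and g: "continuous_on S g"
  shows "op_calculus (\<lambda>t. f t * g t) A = op_calculus f A o\<^sub>L op_calculus g A"
proof -
  obtain p where p: "uniform_limit S (\<lambda>n. poly (p n)) f sequentially"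
    "(\<lambda>n. op_poly (p n) A) \<longlonglongrightarrow> op_calculus f A"
    using op_calculus_approx[OF A S f] .
  obtain q where q: "uniform_limit S (\<lambda>n. poly (q n)) g sequentially"
    "(\<lambda>n. op_poly (q n) A) \<longlonglongrightarrow> op_calculus g A"
    using op_calculus_approx[OF A S g] .
  have bounded: "bounded (f ` S)" "bounded (g ` S)"
    using S(1) f g by (auto intro: compact_imp_bounded compact_continuous_image)
  have "uniform_limit S (\<lambda>n t. poly (p n) t * poly (q n) t) (\<lambda>t. f t * g t) sequentially"
    by (rule bounded_bilinear.bounded_uniform_limit[OF bounded_bilinear_mult p(1) q(1) bounded(2,1)])
  then have "uniform_limit (op_spectrum A) (\<lambda>n t. poly (p n) t * poly (q n) t) (\<lambda>t. f t * g t) sequentially"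
    by (rule uniform_limit_on_subset[OF _ S(2)])
  moreover have "(\<lambda>n. poly (p n * q n)) = (\<lambda>n t. poly (p n) t * poly (q n) t)"
    by (simp add: fun_eq_iff)
  ultimately have "uniform_limit (op_spectrum A) (\<lambda>n. poly (p n * q n)) (\<lambda>t. f t * g t) sequentially"
    by simp
  then have "(\<lambda>n. op_poly (p n * q n) A) \<longlonglongrightarrow> op_calculus (\<lambda>t. f t * g t) A"
    using f g by (intro op_calculus_limit[OF A S] continuous_intros)
  moreover have "(\<lambda>n. op_poly (p n * q n) A) \<longlonglongrightarrow> (op_calculus f A o\<^sub>L op_calculus g A)"
    unfolding op_poly_mult by (intro tendsto_intros p q)
  ultimately show ?thesis by (rule LIMSEQ_unique)
qed

text \<open>Approximants of \<open>f\<close> and \<open>g\<close> need not be ordered, but adding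
  \<open>e\<close> to that of \<open>g\<close> eventually restores the order on the spectrum.
  \<open>op_poly_nonneg\<close> then applies, and \<open>e\<close> tends to 0.\<close>

lemma op_calculus_mono:
  assumes A: "selfadjoint A" and S: "compact S" "op_spectrum A \<subseteq> S"
    and f: "continuous_on S f" and g: "continuous_on S g"
    and mono: "\<And>t. t \<in> op_spectrum A \<Longrightarrow> f t \<le> g t"
  shows "op_calculus f A x \<bullet> x \<le> op_calculus g A x \<bullet> x"
proof -
  obtain p where p: "uniform_limit S (\<lambda>n. poly (p n)) f sequentially"
    "(\<lambda>n. op_poly (p n) A) \<longlonglongrightarrow> op_calculus f A"
    using op_calculus_approx[OF A S f] .
  obtain q where q: "uniform_limit S (\<lambda>n. poly (q n)) g sequentially"
    "(\<lambda>n. op_poly (q n) A) \<longlonglongrightarrow> op_calculus g A"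
    using op_calculus_approx[OF A S g] .
  have le: "op_calculus f A x \<bullet> x - op_calculus g A x \<bullet> x \<le> e * (x \<bullet> x)" if "0 < e" for e
  proof (rule tendsto_le[OF trivial_limit_sequentially])
    show "(\<lambda>n. op_poly (p n) A x \<bullet> x - op_poly (q n) A x \<bullet> x)
        \<longlonglongrightarrow> op_calculus f A x \<bullet> x - op_calculus g A x \<bullet> x"
      by (intro tendsto_intros p q)
    have "\<forall>\<^sub>F n in sequentially. \<forall>t\<in>S. dist (poly (p n) t) (f t) < e / 2"
      "\<forall>\<^sub>F n in sequentially. \<forall>t\<in>S. dist (poly (q n) t) (g t) < e / 2"
      using uniform_limitD[OF p(1), of "e / 2"] uniform_limitD[OF q(1), of "e / 2"] that by simp_all
    then show "\<forall>\<^sub>F n in sequentially. op_poly (p n) A x \<bullet> x - op_poly (q n) A x \<bullet> x \<le> e * (x \<bullet> x)"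
    proof eventually_elim
      case (elim n)
      have "0 \<le> op_poly ([:e:] + q n - p n) A x \<bullet> x"
      proof (rule op_poly_nonneg[OF A])
        fix t assume t: "t \<in> op_spectrum A"
        then have "\<bar>poly (p n) t - f t\<bar> < e / 2" "\<bar>poly (q n) t - g t\<bar> < e / 2"
          using elim S(2) by (auto simp: dist_real_def)
        then have "0 \<le> e + poly (q n) t - poly (p n) t" using mono[OF t] by linarith
        then show "0 \<le> poly ([:e:] + q n - p n) t" by simp
      qed
      then show ?case
        by (simp add: op_poly_diff op_poly_add op_poly_const blinfun.bilinear_simps inner_simps)
    qed
  qed simp
  have "((\<lambda>e. e * (x \<bullet> x)) \<longlongrightarrow> 0 * (x \<bullet> x)) (at_right 0)"
    by (intro tendsto_intros)
  moreover have "\<forall>\<^sub>F e in at_right 0. op_calculus f A x \<bullet> x - op_calculus g A x \<bullet> x \<le> e * (x \<bullet> x)"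
    using eventually_at_right_less[of "0::real"] by (rule eventually_mono) (rule le)
  ultimately have "op_calculus f A x \<bullet> x - op_calculus g A x \<bullet> x \<le> 0 * (x \<bullet> x)"
    by (rule tendsto_lowerbound) simp
  then show ?thesis by simp
qed

section \<open>Fractional powers and interpolation\<close>

text \<open>Weighted arithmetic-geometric mean inequality. It gives both the tangent-line bound for
  powers and the Young step of part (ii).\<close>

lemma powr_mult_powr_le:
  fixes a b \<alpha> :: real
  assumes "0 < \<alpha>" "\<alpha> \<le> 1" "0 \<le> a" "0 \<le> b"
  shows "a powr \<alpha> * b powr (1 - \<alpha>) \<le> \<alpha> * a + (1 - \<alpha>) * b"
proof (cases "a = 0 \<or> b = 0")
  case True
  with assms show ?thesis by auto
next
  case False
  with assms show ?thesis using Youngs_inequality_0[of \<alpha> "1 - \<alpha>" a b] by simp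
qed

context
  fixes A :: "'a::{real_inner,complete_space} \<Rightarrow>\<^sub>L 'a"
  assumes sa: "selfadjoint A" and pos: "\<And>x. 0 \<le> A x \<bullet> x"
begin

lemma op_spectrum_Icc: "op_spectrum A \<subseteq> {0..norm A}"
  using op_spectrum_le_norm[OF sa] op_spectrum_nonneg[OF sa pos] by force

lemma continuous_on_powr_const: "0 < r \<Longrightarrow> continuous_on {0..norm A} (\<lambda>t. t powr r)"
  by (intro continuous_on_powr' continuous_intros) auto

lemma op_powr_selfadjoint: "0 < r \<Longrightarrow> selfadjoint (op_powr A r)"
  unfolding op_powr_def
  by (rule op_calculus_selfadjoint[OF sa compact_Icc op_spectrum_Icc continuous_on_powr_const])

text \<open>Taken at \<open>r = \<nu> / 2\<close>, this reduces the norm estimate of part (i) to the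
  quadratic form of the power \<open>\<nu>\<close>.\<close>

lemma norm_op_powr_square:
  assumes "0 < r"
  shows "(norm (op_powr A r x))\<^sup>2 = op_powr A (2 * r) x \<bullet> x"
proof -
  have "op_powr A (2 * r) = op_calculus (\<lambda>t. t powr r * t powr r) A"
    unfolding op_powr_def by (simp flip: powr_add)
  also have "\<dots> = op_powr A r o\<^sub>L op_powr A r"
    unfolding op_powr_def using assms
    by (intro op_calculus_mult[OF sa compact_Icc op_spectrum_Icc] continuous_on_powr_const)
  finally show ?thesis
    using op_powr_selfadjoint[OF assms] by (simp add: selfadjoint_def power2_norm_eq_inner)
qed

lemma op_powr_1: "op_powr A 1 = A"
proof -
  have "op_powr A 1 = op_calculus (poly [:0, 1:]) A"
    unfolding op_powr_def using op_spectrum_Icc by (intro op_calculus_cong) auto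
  then show ?thesis by (simp add: op_calculus_poly[OF sa] op_poly_linear)
qed

text \<open>The interpolation inequality follows from its tangent-line form
  \<open>t\<^sup>\<nu> \<le> \<nu> s\<^bsup>\<nu>-1\<^esup> t + (1 - \<nu>) s\<^sup>\<nu>\<close>, which is affine in \<open>t\<close>, by optimizing over \<open>s\<close>.\<close>

lemma op_powr_tangent:
  assumes "0 < \<nu>" "\<nu> \<le> 1" "0 < s"
  shows "op_powr A \<nu> x \<bullet> x \<le> \<nu> * s powr (\<nu> - 1) * (A x \<bullet> x) + (1 - \<nu>) * s powr \<nu> * (x \<bullet> x)"
proof -
  define q where "q = [:(1 - \<nu>) * s powr \<nu>, \<nu> * s powr (\<nu> - 1):]"
  have "op_powr A \<nu> x \<bullet> x \<le> op_calculus (poly q) A x \<bullet> x"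
    unfolding op_powr_def
  proof (rule op_calculus_mono[OF sa compact_Icc op_spectrum_Icc])
    show "continuous_on {0..norm A} (\<lambda>t. t powr \<nu>)" using assms by (intro continuous_on_powr_const)
    fix t assume "t \<in> op_spectrum A"
    then have "0 \<le> t" using op_spectrum_Icc by auto
    then have "t powr \<nu> * s powr (1 - \<nu>) \<le> \<nu> * t + (1 - \<nu>) * s"
      using assms by (intro powr_mult_powr_le) auto
    then have "t powr \<nu> * s powr (1 - \<nu>) * s powr (\<nu> - 1) \<le> (\<nu> * t + (1 - \<nu>) * s) * s powr (\<nu> - 1)"
      by (intro mult_right_mono) auto
    also have "\<dots> = (1 - \<nu>) * (s * s powr (\<nu> - 1)) + t * (\<nu> * s powr (\<nu> - 1))"
      by (simp add: algebra_simps)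
    also have "s * s powr (\<nu> - 1) = s powr \<nu>"
      using assms(3) by (simp add: powr_mult_base)
    also have "t powr \<nu> * s powr (1 - \<nu>) * s powr (\<nu> - 1) = t powr \<nu>"
      using assms(3) by (simp add: mult.assoc flip: powr_add)
    finally show "t powr \<nu> \<le> poly q t"
      by (simp add: q_def)
  qed (intro continuous_intros)
  then show ?thesis
    by (simp add: op_calculus_poly[OF sa] q_def op_poly_linear blinfun.bilinear_simps inner_simps)
qed

lemma op_powr_interpolation:
  assumes \<nu>: "0 < \<nu>" "\<nu> < 1"
  shows "op_powr A \<nu> x \<bullet> x \<le> (A x \<bullet> x) powr \<nu> * (x \<bullet> x) powr (1 - \<nu>)"
proof (cases "x = 0")
  case False
  then have xx: "0 < x \<bullet> x" by simp
  show ?thesis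
  proof (cases "A x \<bullet> x = 0")
    case True
    have "op_powr A \<nu> x \<bullet> x \<le> 0 + e" if "0 < e" for e
    proof -
      \<comment> \<open>The optimal \<open>s\<close> would be 0 here, so a small positive one is
        chosen with \<open>s powr \<nu> * (x \<bullet> x) = e\<close>.\<close>
      define s where "s = (e / (x \<bullet> x)) powr (1 / \<nu>)"
      have "0 < e / (x \<bullet> x)" using that xx by simp
      then have "0 < s" "s powr \<nu> = e / (x \<bullet> x)" using that \<nu> by (auto simp: s_def powr_powr)
      then have "op_powr A \<nu> x \<bullet> x \<le> (1 - \<nu>) * e"
        using op_powr_tangent[of \<nu> s x] \<nu> True xx by simp
      also have "\<dots> \<le> e" using that \<nu> by (simp add: field_simps)
      finally show ?thesis by simp
    qed
    then have "op_powr A \<nu> x \<bullet> x \<le> 0" by (rule field_le_epsilon)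
    then show ?thesis using True by simp
  next
    case False
    then have Ax: "0 < A x \<bullet> x" using pos[of x] by linarith
    \<comment> \<open>The Rayleigh quotient minimizes the tangent-line bound over \<open>s\<close>;
      there the two terms add up to \<open>s powr \<nu> * (x \<bullet> x)\<close>.\<close>
    define s where "s = (A x \<bullet> x) / (x \<bullet> x)"
    have "0 < s" using Ax xx by (simp add: s_def)
    have "s powr (\<nu> - 1) * (A x \<bullet> x) = s powr (\<nu> - 1) * s * (x \<bullet> x)"
      using xx by (simp add: s_def)
    also have "\<dots> = s powr \<nu> * (x \<bullet> x)"
      using \<open>0 < s\<close> by (simp add: powr_mult_base mult.commute)
    finally have "op_powr A \<nu> x \<bullet> x \<le> s powr \<nu> * (x \<bullet> x)"
      using op_powr_tangent[of \<nu> s x] \<nu> \<open>0 < s\<close> by (simp add: algebra_simps)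
    also have "\<dots> = (A x \<bullet> x) powr \<nu> * (x \<bullet> x) powr (1 - \<nu>)"
      using Ax xx by (simp add: s_def powr_divide powr_diff)
    finally show ?thesis .
  qed
qed simp

end

section \<open>Powers of \<open>blinfun_adjoint L o\<^sub>L L\<close>\<close>

lemma
  fixes L :: "'u::{real_inner,complete_space} \<Rightarrow>\<^sub>L 'v::{real_inner,complete_space}"
  shows adjoint_compose_inner: "(blinfun_adjoint L o\<^sub>L L) x \<bullet> x = (norm (L x))\<^sup>2"
    and adjoint_compose_nonneg: "0 \<le> (blinfun_adjoint L o\<^sub>L L) x \<bullet> x"
    and adjoint_compose_selfadjoint: "selfadjoint (blinfun_adjoint L o\<^sub>L L)"
proof -
  show "(blinfun_adjoint L o\<^sub>L L) x \<bullet> x = (norm (L x))\<^sup>2"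
    by (simp add: blinfun_adjoint_inner power2_norm_eq_inner)
  then show "0 \<le> (blinfun_adjoint L o\<^sub>L L) x \<bullet> x" by simp
  show "selfadjoint (blinfun_adjoint L o\<^sub>L L)"
    by (simp add: selfadjoint_def blinfun_adjoint_inner inner_blinfun_adjoint)
qed

text \<open>The square root is the modulus of \<open>L\<close>: both squared norms equal the
  quadratic form of L*L at \<open>x\<close>. This serves part (iii) and the case
  \<open>\<nu> = 1\<close> of part (i).\<close>

lemma norm_op_powr_half:
  fixes L :: "'u::{real_inner,complete_space} \<Rightarrow>\<^sub>L 'v::{real_inner,complete_space}"
  shows "norm (op_powr (blinfun_adjoint L o\<^sub>L L) (1 / 2) x) = norm (L x)"
  using norm_op_powr_square[OF adjoint_compose_selfadjoint[of L] adjoint_compose_nonneg[of L], of "1 / 2" x]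
    op_powr_1[OF adjoint_compose_selfadjoint[of L] adjoint_compose_nonneg[of L]]
  by (simp add: blinfun_adjoint_inner power2_norm_eq_inner[symmetric])

lemma norm_op_powr_le:
  fixes L :: "'u::{real_inner,complete_space} \<Rightarrow>\<^sub>L 'v::{real_inner,complete_space}"
  assumes "0 < \<nu>" "\<nu> < 1"
  shows "norm (op_powr (blinfun_adjoint L o\<^sub>L L) (\<nu> / 2) x) \<le> norm (L x) powr \<nu> * norm x powr (1 - \<nu>)"
proof (rule power2_le_imp_le)
  have sq: "(a\<^sup>2) powr r = (a powr r)\<^sup>2" if "0 \<le> a" for a r :: real
    using that by (simp add: power2_eq_square powr_mult)
  have "(norm (op_powr (blinfun_adjoint L o\<^sub>L L) (\<nu> / 2) x))\<^sup>2
      \<le> ((norm (L x))\<^sup>2) powr \<nu> * ((norm x)\<^sup>2) powr (1 - \<nu>)"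
    using norm_op_powr_square[OF adjoint_compose_selfadjoint[of L] adjoint_compose_nonneg[of L], of "\<nu> / 2" x]
      op_powr_interpolation[OF adjoint_compose_selfadjoint[of L] adjoint_compose_nonneg[of L], of \<nu> x] assms
    by (simp only: adjoint_compose_inner power2_norm_eq_inner[of x]) simp
  also have "\<dots> = (norm (L x) powr \<nu> * norm x powr (1 - \<nu>))\<^sup>2"
    by (simp add: sq power_mult_distrib)
  finally show "(norm (op_powr (blinfun_adjoint L o\<^sub>L L) (\<nu> / 2) x))\<^sup>2
      \<le> (norm (L x) powr \<nu> * norm x powr (1 - \<nu>))\<^sup>2" .
qed simp

section \<open>Source conditions and variational inequalities\<close>

lemma source_condition_imp_homogeneous_VI:
  assumes \<nu>: "0 < \<nu>" "\<nu> \<le> 1" and "source_condition L u \<nu>"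
  shows "homogeneous_VI L u \<nu>"
proof -
  define B where "B = op_powr (blinfun_adjoint L o\<^sub>L L) (\<nu> / 2)"
  obtain w where w: "u = B w" using assms(3) by (auto simp: source_condition_def B_def)
  have B: "selfadjoint B"
    using op_powr_selfadjoint[OF adjoint_compose_selfadjoint[of L] adjoint_compose_nonneg[of L]] \<nu>(1)
    by (simp add: B_def)
  have "2 * (u \<bullet> v)
      \<le> (2 * norm w) * norm (L v) powr \<nu> * (if \<nu> = 1 then 1 else norm v powr (1 - \<nu>))" for v
  proof -
    have "norm (B v) \<le> norm (L v) powr \<nu> * (if \<nu> = 1 then 1 else norm v powr (1 - \<nu>))"
      using norm_op_powr_half[of L v] norm_op_powr_le[of \<nu> L v] \<nu> by (auto simp: B_def)
    from mult_left_mono[OF this, of "2 * norm w"]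
    have "2 * (norm w * norm (B v))
        \<le> (2 * norm w) * norm (L v) powr \<nu> * (if \<nu> = 1 then 1 else norm v powr (1 - \<nu>))"
      by (simp only: mult.assoc norm_ge_zero mult_nonneg_nonneg zero_le_numeral simp_thms)
    moreover have "u \<bullet> v \<le> norm w * norm (B v)"
      using B norm_cauchy_schwarz[of w "B v"] by (simp add: w selfadjoint_def)
    ultimately show ?thesis by linarith
  qed
  then show ?thesis
    unfolding homogeneous_VI_def by (intro exI[of _ "2 * norm w"]) simp
qed

text \<open>Young's inequality with weights \<open>\<alpha> = (1 + \<nu>) / 2\<close> and
  \<open>1 - \<alpha>\<close>. This \<open>\<alpha>\<close> turns
  \<open>norm v powr (1 - \<nu>)\<close> into the power \<open>1 - \<alpha>\<close> of the squared
  norm, and then \<open>norm (L v)\<close> gets the exponent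
  \<open>\<nu> / \<alpha> = 2 * \<nu> / (1 + \<nu>)\<close>. The new \<open>\<gamma>\<close> is
  \<open>1 - \<alpha>\<close>, which is below 1.\<close>

lemma homogeneous_VI_imp_inhomogeneous_VI:
  assumes \<nu>: "0 < \<nu>" "\<nu> \<le> 1" and "homogeneous_VI L u \<nu>"
  shows "inhomogeneous_VI L u (2 * \<nu> / (1 + \<nu>))"
proof -
  obtain \<beta> where \<beta>: "0 \<le> \<beta>" and ineq: "\<And>v. 2 * (u \<bullet> v) \<le>
      \<beta> * norm (L v) powr \<nu> * (if \<nu> = 1 then 1 else norm v powr (1 - \<nu>))"
    using assms(3) unfolding homogeneous_VI_def by blast
  define \<alpha> where "\<alpha> = (1 + \<nu>) / 2"
  have \<alpha>: "0 < \<alpha>" "\<alpha> \<le> 1" "\<nu> / \<alpha> = 2 * \<nu> / (1 + \<nu>)" "2 * (1 - \<alpha>) = 1 - \<nu>"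
    using \<nu> by (auto simp: \<alpha>_def field_simps)
  have "2 * (u \<bullet> v) \<le> (\<alpha> * \<beta> powr (1 / \<alpha>)) * norm (L v) powr (2 * \<nu> / (1 + \<nu>)) + (1 - \<alpha>) * (norm v)\<^sup>2" for v
  proof (cases "\<nu> = 1")
    \<comment> \<open>Here \<open>\<alpha> = 1\<close>: the quadratic term has coefficient 0, and
      the hypothesis, whose last factor is 1 by convention, is already the claim.\<close>
    case True
    then show ?thesis using ineq[of v] \<beta> by (simp add: \<alpha>_def)
  next
    case False
    define X where "X = (\<beta> * norm (L v) powr \<nu>) powr (1 / \<alpha>)"
    have X: "X powr \<alpha> = \<beta> * norm (L v) powr \<nu>"
      using \<alpha> \<beta> by (simp add: X_def powr_powr)
    have X': "X = \<beta> powr (1 / \<alpha>) * norm (L v) powr (2 * \<nu> / (1 + \<nu>))"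
      using \<alpha> \<beta> by (simp add: X_def powr_mult powr_powr flip: \<alpha>(3))
    have "((norm v)\<^sup>2) powr (1 - \<alpha>) = norm v powr (1 - \<nu>)"
    proof (cases "v = 0")
      case False
      then have "((norm v)\<^sup>2) powr (1 - \<alpha>) = (norm v powr 2) powr (1 - \<alpha>)" by simp
      then show ?thesis by (simp only: powr_powr \<alpha>(4))
    qed simp
    then have "2 * (u \<bullet> v) \<le> X powr \<alpha> * ((norm v)\<^sup>2) powr (1 - \<alpha>)"
      using ineq[of v] False by (simp add: X)
    also have "\<dots> \<le> \<alpha> * X + (1 - \<alpha>) * (norm v)\<^sup>2"
      using \<alpha> by (intro powr_mult_powr_le) (auto simp: X_def)
    finally show ?thesis by (simp add: X' mult.assoc)
  qed
  moreover have "0 \<le> \<alpha> * \<beta> powr (1 / \<alpha>)" "1 - \<alpha> \<in> {0..<1}" using \<alpha> by auto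
  ultimately show ?thesis unfolding inhomogeneous_VI_def by blast
qed

text \<open>Replacing \<open>v\<close> by \<open>t v\<close> and letting \<open>t\<close> tend to 0 removes the quadratic term.\<close>

lemma inhomogeneous_VI_1_imp_bound:
  assumes "inhomogeneous_VI L u 1"
  obtains C where "\<And>v. \<bar>u \<bullet> v\<bar> \<le> C * norm (L v)"
proof -
  obtain \<beta> \<gamma> where ineq: "\<And>v. 2 * (u \<bullet> v) \<le> \<beta> * norm (L v) powr 1 + \<gamma> * (norm v)\<^sup>2"
    using assms unfolding inhomogeneous_VI_def by blast
  have le: "u \<bullet> v \<le> \<beta> / 2 * norm (L v)" for v
  proof -
    have "2 * (u \<bullet> v) \<le> \<beta> * norm (L v) + \<gamma> * t * (norm v)\<^sup>2" if "0 < t" for t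
    proof -
      \<comment> \<open>With exponent 1 the term in \<open>norm (L v)\<close> scales like the left
        side, so after division by \<open>t\<close> only the quadratic term keeps a factor
        \<open>t\<close>.\<close>
      have "t * (2 * (u \<bullet> v)) \<le> t * (\<beta> * norm (L v) + \<gamma> * t * (norm v)\<^sup>2)"
        using ineq[of "t *\<^sub>R v"] that
        by (simp add: blinfun.bilinear_simps power_mult_distrib algebra_simps power2_eq_square)
      then show ?thesis using that by (simp del: distrib_left)
    qed
    then have "\<forall>\<^sub>F t in at_right 0. 2 * (u \<bullet> v) \<le> \<beta> * norm (L v) + \<gamma> * t * (norm v)\<^sup>2"
      using eventually_at_right_less[of "0::real"] by (rule eventually_mono[rotated])
    moreover have "((\<lambda>t. \<beta> * norm (L v) + \<gamma> * t * (norm v)\<^sup>2)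
        \<longlongrightarrow> \<beta> * norm (L v) + \<gamma> * 0 * (norm v)\<^sup>2) (at_right 0)"
      by (intro tendsto_intros)
    ultimately have "2 * (u \<bullet> v) \<le> \<beta> * norm (L v) + \<gamma> * 0 * (norm v)\<^sup>2"
      by (intro tendsto_lowerbound) auto
    then show ?thesis by simp
  qed
  have "\<bar>u \<bullet> v\<bar> \<le> \<beta> / 2 * norm (L v)" for v
    using le[of v] le[of "- v"] by (simp add: blinfun.bilinear_simps abs_le_iff)
  then show thesis by (rule that)
qed

text \<open>The functional is factored through \<open>B\<close> instead of \<open>L\<close>, which
  is possible as \<open>norm (B v) = norm (L v)\<close>. Since \<open>B\<close> is self-adjoint,
  this places \<open>u\<close> in the range of \<open>B\<close> itself.\<close>

lemma inhomogeneous_VI_imp_source_condition: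
  assumes "inhomogeneous_VI L u 1"
  shows "source_condition L u 1"
proof -
  define B where "B = op_powr (blinfun_adjoint L o\<^sub>L L) (1 / 2)"
  have lin_u: "linear (\<lambda>v. u \<bullet> v)"
    by (rule linearI) (simp_all add: inner_simps)
  have lin_B: "linear (blinfun_apply B)"
    by (rule linearI) (simp_all add: blinfun.bilinear_simps)
  obtain C where "\<And>v. \<bar>u \<bullet> v\<bar> \<le> C * norm (L v)"
    using inhomogeneous_VI_1_imp_bound[OF assms] by metis
  then have "\<bar>u \<bullet> v\<bar> \<le> C * norm (B v)" for v by (simp add: B_def norm_op_powr_half)
  from functional_factorization[OF lin_B lin_u this]
  obtain w where "\<And>v. u \<bullet> v = w \<bullet> B v" by metis
  moreover have "selfadjoint B"
    using op_powr_selfadjoint[OF adjoint_compose_selfadjoint[of L] adjoint_compose_nonneg[of L]]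
    by (simp add: B_def)
  ultimately have "u \<bullet> v = B w \<bullet> v" for v by (simp add: selfadjoint_def)
  then have "u = B w" using vector_eq_rdot by blast
  then show ?thesis by (simp add: source_condition_def B_def)
qed

theorem lemma2:
  fixes L :: "'u::{real_inner,complete_space} \<Rightarrow>\<^sub>L 'v::{real_inner,complete_space}"
    and y :: 'v and u\<^sub>d :: 'u and \<nu> :: real
  assumes "y \<in> range (blinfun_apply L)"
    and "0 < \<nu>" and "\<nu> \<le> 1"
    and "u\<^sub>d = min_norm_solution L y"
  shows "(source_condition L u\<^sub>d \<nu> \<longrightarrow> homogeneous_VI L u\<^sub>d \<nu>) \<and>
         (homogeneous_VI L u\<^sub>d \<nu> \<longrightarrow> inhomogeneous_VI L u\<^sub>d (2 * \<nu> / (1 + \<nu>))) \<and>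
         (inhomogeneous_VI L u\<^sub>d 1 \<longrightarrow> source_condition L u\<^sub>d 1)"
  using assms source_condition_imp_homogeneous_VI homogeneous_VI_imp_inhomogeneous_VI
    inhomogeneous_VI_imp_source_condition by blast

end
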